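(* Let $t\in[0,1)$ and let $w=(w(n))_{n=0}^\infty$ be any strictly positive weight on $\mathbb{N}_0$ satisfying $w(n)\downarrow0$ (that is, $w$ is decreasing with limit $0$). The operator $\mathcal{C}_t\in\mathcal{L}(c_0(w))$ satisfies $\|\mathcal{C}_t\|_{c_0(w)\to c_0(w)}\le(1-t)^{-1}$, is compact and has spectrum $\sigma(\mathcal{C}_t;c_0(w))=\Lambda\cup\{0\}$. Moreover, the fine spectra of $\mathcal{C}_t$ are given by $$\sigma_{\mathrm p}(\mathcal{C}_t;c_0(w))=\Lambda,\quad \sigma_{\mathrm c}(\mathcal{C}_t;c_0(w))=\{0\},\quad \sigma_{\mathrm r}(\mathcal{C}_t;c_0(w))=\emptyset.$$
   Context: Let $\mathbb{N}_0=\{0,1,2,\dots\}$ and $\Lambda:=\{1/(n+1):n\in\mathbb{N}_0\}$. For $t\in[0,1]$ the generalized Cesàro operator on $\mathbb{C}^{\mathbb{N}_0}$ is $(\mathcal{C}_tx)_n=\frac{1}{n+1}\sum_{k=0}^n t^{n-k}x_k$ (with $0^0=1$). $\mathcal{C}_t\in\mathcal{L}(X)$ means that it maps $X$ continuously into itself; the restriction is also denoted $\mathcal{C}_t$. $c_0(w):=\{x\in\mathbb{C}^{\mathbb{N}_0}:\lim_{n\to\infty}w(n)|x_n|=0\}$ with norm $\|x\|_{0,w}:=\sup_nw(n)|x_n|$. $\mathcal{L}(X)$ is the space of continuous linear operators on $X$. For $T\in\mathcal{L}(X)$: $\sigma(T;X)$ is the set of $\lambda\in\mathbb{C}$ with $T-\lambda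 I$ not invertible in $\mathcal{L}(X)$; $\sigma_{\mathrm p}(T;X)$ is the set of $\lambda$ with $T-\lambda I$ not injective; $\sigma_{\mathrm c}(T;X)$ is the set of $\lambda$ with $T-\lambda I$ injective and range a proper dense subspace of $X$; $\sigma_{\mathrm r}(T;X)$ is the set of $\lambda$ with $T-\lambda I$ injective and range not dense in $X$. *)

theory Defs
  imports "HOL-Analysis.Analysis"
begin

text \<open>
  A normed space of complex sequences is represented by its carrier \<open>X\<close> together with its norm
  \<open>N\<close>, because the weighted spaces below depend on a parameter and so do not form a type.
  The vector space operations are the pointwise ones.
\<close>

type_synonym cseq = "nat \<Rightarrow> complex"

text \<open>
  The locale \<open>Metric_space\<close> requires the distance to be nonnegative and symmetric even off the
  carrier, where \<open>N\<close> need not be meaningful; hence the default value \<open>0\<close> there.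
\<close>

definition seq_dist :: "cseq set \<Rightarrow> (cseq \<Rightarrow> real) \<Rightarrow> cseq \<Rightarrow> cseq \<Rightarrow> real" where
  "seq_dist X N x y = (if x \<in> X \<and> y \<in> X then N (\<lambda>n. x n - y n) else 0)"

definition norm_topology :: "cseq set \<Rightarrow> (cseq \<Rightarrow> real) \<Rightarrow> cseq topology" where
  "norm_topology X N = Metric_space.mtopology X (seq_dist X N)"

text \<open>
  Operators are total functions on sequences; only their values on \<open>X\<close> matter. In particular
  membership in \<open>cont_linear_ops X N\<close> concerns the restriction to \<open>X\<close>.
\<close>

definition cont_linear_ops :: "cseq set \<Rightarrow> (cseq \<Rightarrow> real) \<Rightarrow> (cseq \<Rightarrow> cseq) set" where
  "cont_linear_ops X N = {T.
     T ` X \<subseteq> X \<and>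
     (\<forall>x\<in>X. \<forall>y\<in>X. T (\<lambda>n. x n + y n) = (\<lambda>n. T x n + T y n)) \<and>
     (\<forall>c. \<forall>x\<in>X. T (\<lambda>n. c * x n) = (\<lambda>n. c * T x n)) \<and>
     continuous_map (norm_topology X N) (norm_topology X N) T}"

definition op_norm :: "cseq set \<Rightarrow> (cseq \<Rightarrow> real) \<Rightarrow> (cseq \<Rightarrow> cseq) \<Rightarrow> real" where
  "op_norm X N T = (SUP x\<in>{x\<in>X. N x \<le> 1}. N (T x))"

definition compact_op :: "cseq set \<Rightarrow> (cseq \<Rightarrow> real) \<Rightarrow> (cseq \<Rightarrow> cseq) \<Rightarrow> bool" where
  "compact_op X N T \<longleftrightarrow>
     T \<in> cont_linear_ops X N \<and>
     compactin (norm_topology X N) (norm_topology X N closure_of (T ` {x\<in>X. N x \<le> 1}))"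

definition minus_scalar :: "(cseq \<Rightarrow> cseq) \<Rightarrow> complex \<Rightarrow> cseq \<Rightarrow> cseq" where
  "minus_scalar T l x = (\<lambda>n. T x n - l * x n)"

definition invertible_op :: "cseq set \<Rightarrow> (cseq \<Rightarrow> real) \<Rightarrow> (cseq \<Rightarrow> cseq) \<Rightarrow> bool" where
  "invertible_op X N T \<longleftrightarrow>
     (\<exists>S\<in>cont_linear_ops X N. \<forall>x\<in>X. S (T x) = x \<and> T (S x) = x)"

definition spectrum_op :: "cseq set \<Rightarrow> (cseq \<Rightarrow> real) \<Rightarrow> (cseq \<Rightarrow> cseq) \<Rightarrow> complex set" where
  "spectrum_op X N T = {l. \<not> invertible_op X N (minus_scalar T l)}"

definition point_spectrum :: "cseq set \<Rightarrow> (cseq \<Rightarrow> cseq) \<Rightarrow> complex set" where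
  "point_spectrum X T = {l. \<not> inj_on (minus_scalar T l) X}"

definition continuous_spectrum :: "cseq set \<Rightarrow> (cseq \<Rightarrow> real) \<Rightarrow> (cseq \<Rightarrow> cseq) \<Rightarrow> complex set" where
  "continuous_spectrum X N T = {l. inj_on (minus_scalar T l) X \<and>
     minus_scalar T l ` X \<subset> X \<and>
     norm_topology X N closure_of (minus_scalar T l ` X) = X}"

definition residual_spectrum :: "cseq set \<Rightarrow> (cseq \<Rightarrow> real) \<Rightarrow> (cseq \<Rightarrow> cseq) \<Rightarrow> complex set" where
  "residual_spectrum X N T = {l. inj_on (minus_scalar T l) X \<and>
     norm_topology X N closure_of (minus_scalar T l ` X) \<noteq> X}"

definition c0 :: "(nat \<Rightarrow> real) \<Rightarrow> cseq set" where
  "c0 w = {x. (\<lambda>n. w n * cmod (x n)) \<longlonglongrightarrow> 0}"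

definition c0_norm :: "(nat \<Rightarrow> real) \<Rightarrow> cseq \<Rightarrow> real" where
  "c0_norm w x = (SUP n. w n * cmod (x n))"

definition cesaro :: "real \<Rightarrow> cseq \<Rightarrow> cseq" where
  "cesaro t x = (\<lambda>n. 1 / of_nat (n + 1) * (\<Sum>k=0..n. of_real t ^ (n - k) * x k))"

definition Lam :: "complex set" where
  "Lam = {1 / of_nat (n + 1) | n :: nat. True}"

lemma c0_bdd_above:
  assumes "x \<in> c0 w"
  shows "bdd_above (range (\<lambda>n. w n * cmod (x n)))"
proof -
  have "convergent (\<lambda>n. w n * cmod (x n))"
    using assms unfolding c0_def convergent_def by blast
  then show ?thesis
    by (intro Bseq_bdd_above convergent_imp_Bseq)
qed

lemma c0_norm_upper: "x \<in> c0 w \<Longrightarrow> w n * cmod (x n) \<le> c0_norm w x"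
  unfolding c0_norm_def by (rule cSUP_upper[OF _ c0_bdd_above]) auto

lemma c0_diff:
  assumes w: "\<And>n. 0 < w n" and x: "x \<in> c0 w" and y: "y \<in> c0 w"
  shows "(\<lambda>n. x n - y n) \<in> c0 w"
proof -
  have "(\<lambda>n. w n * cmod (x n) + w n * cmod (y n)) \<longlonglongrightarrow> 0"
    using tendsto_add[of "\<lambda>n. w n * cmod (x n)" 0 sequentially "\<lambda>n. w n * cmod (y n)" 0] x y
    by (simp add: c0_def)
  moreover have "norm (w n * cmod (x n - y n)) \<le> w n * cmod (x n) + w n * cmod (y n)" for n
    using mult_left_mono[OF norm_triangle_ineq4[of "x n" "y n"], of "w n"] w[of n]
    by (simp add: abs_mult distrib_left)
  ultimately show ?thesis
    unfolding c0_def mem_Collect_eq by (rule Lim_null_comparison[OF always_eventually, OF allI, rotated])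
qed

lemma Metric_space_c0:
  assumes w: "\<And>n. 0 < w n"
  shows "Metric_space (c0 w) (seq_dist (c0 w) (c0_norm w))"
proof
  have up: "w n * cmod (x n - y n) \<le> seq_dist (c0 w) (c0_norm w) x y"
    if "x \<in> c0 w" "y \<in> c0 w" for x y n
    using c0_norm_upper[OF c0_diff[OF w that]] that by (simp add: seq_dist_def)
  fix x y
  show "0 \<le> seq_dist (c0 w) (c0_norm w) x y"
  proof (cases "x \<in> c0 w \<and> y \<in> c0 w")
    case True
    have "0 \<le> w 0 * cmod (x 0 - y 0)"
      using w[of 0] by simp
    also have "\<dots> \<le> seq_dist (c0 w) (c0_norm w) x y"
      using True by (intro up) auto
    finally show ?thesis .
  qed (auto simp: seq_dist_def)
  show "seq_dist (c0 w) (c0_norm w) x y = seq_dist (c0 w) (c0_norm w) y x"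
    by (simp add: seq_dist_def c0_norm_def norm_minus_commute)
  show "(seq_dist (c0 w) (c0_norm w) x y = 0) = (x = y)" if "x \<in> c0 w" "y \<in> c0 w"
  proof
    assume *: "seq_dist (c0 w) (c0_norm w) x y = 0"
    have "x n = y n" for n
    proof -
      have "w n * cmod (x n - y n) \<le> 0"
        using up[OF that, of n] * by simp
      with w[of n] show ?thesis
        by (simp add: mult_le_0_iff)
    qed
    then show "x = y" by auto
  qed (use that in \<open>simp add: seq_dist_def c0_norm_def\<close>)
  show "seq_dist (c0 w) (c0_norm w) x z
      \<le> seq_dist (c0 w) (c0_norm w) x y + seq_dist (c0 w) (c0_norm w) y z"
    if "x \<in> c0 w" "y \<in> c0 w" "z \<in> c0 w" for z
  proof -
    have "w n * cmod (x n - z n)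
        \<le> seq_dist (c0 w) (c0_norm w) x y + seq_dist (c0 w) (c0_norm w) y z" for n
    proof -
      have "w n * cmod (x n - z n) \<le> w n * (cmod (x n - y n) + cmod (y n - z n))"
        using w[of n] norm_triangle_ineq[of "x n - y n" "y n - z n"]
        by (intro mult_left_mono) auto
      also have "\<dots> = w n * cmod (x n - y n) + w n * cmod (y n - z n)"
        by (simp add: distrib_left)
      also have "\<dots> \<le> seq_dist (c0 w) (c0_norm w) x y + seq_dist (c0 w) (c0_norm w) y z"
        using that by (intro add_mono up)
      finally show ?thesis .
    qed
    then have "c0_norm w (\<lambda>n. x n - z n)
        \<le> seq_dist (c0 w) (c0_norm w) x y + seq_dist (c0 w) (c0_norm w) y z"
      unfolding c0_norm_def by (intro cSUP_least) auto
    then show ?thesis using that by (simp add: seq_dist_def[of _ _ x z])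
  qed
qed

end

theory Submission
  imports Defs
begin

text \<open>
  Everything rests on two features of \<open>cesaro t\<close> for \<open>t < 1\<close>. On the one hand
  \<open>(n + 1) (cesaro t x)\<^sub>n\<close> is the convolution of \<open>x\<close> with the geometric sequence \<open>t\<^sup>k\<close>; since \<open>w\<close>
  decreases, a bound \<open>w\<^sub>k \<bar>x\<^sub>k\<bar> \<le> M\<close> for all \<open>k\<close> yields
  \<open>w\<^sub>n \<bar>(cesaro t x)\<^sub>n\<bar> \<le> M / ((1 - t) (n + 1))\<close> (lemma \<open>cesaro_weighted_bound\<close>). This gives the norm
  bound, and also compactness: the sequences dominated in this way form a set on which the
  norm topology is the topology of pointwise convergence, so that Tychonoff's theorem applies
  (lemma \<open>compactin_null_dominated\<close>). It also shows that \<open>cesaro t\<close> maps sequences that are merely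
  bounded with respect to \<open>w\<close> into \<open>c0 w\<close>.

  On the other hand the convolution with a geometric sequence has a two-term inverse: \<open>z\<close> is
  \<open>cesaro t x\<close> exactly if \<open>x\<^sub>n = (n + 1) z\<^sub>n - t n z\<^sub>n\<^sub>-\<^sub>1\<close> (lemma \<open>cesaro_eq_iff\<close>). So every question
  on \<open>cesaro t x - l x = y\<close> becomes a first-order recursion, whose leading coefficient
  \<open>1 - l (n + 1)\<close> vanishes only for \<open>l\<close> in \<open>Lam\<close>. For \<open>l = 1 / (m + 1)\<close> the homogeneous recursion is
  solved by \<open>(n choose m) t\<^sup>n\<^sup>-\<^sup>m\<close>, which is bounded by the binomial theorem and hence lies in
  \<open>c0 w\<close>, as \<open>w\<close> tends to \<open>0\<close>. For \<open>l\<close> outside \<open>Lam \<union> {0}\<close> the coefficients have a ratio whose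
  modulus tends to \<open>t < 1\<close>, so the solution is bounded by a multiple of the right-hand side (lemmas
  \<open>resolvent_recursion_bound\<close> and \<open>resolvent_estimate\<close>) and \<open>cesaro t - l\<close> is invertible. For \<open>l = 0\<close>
  the recursion shows that the range contains all finitely supported sequences, hence is dense,
  while it misses the sequence \<open>1 / ((n + 1) w\<^sub>n)\<close>.
\<close>

section \<open>Weighted null sequences\<close>

lemma tendsto_const_div_Suc: "(\<lambda>n. c / real (n + 1)) \<longlonglongrightarrow> 0"
  using LIMSEQ_ignore_initial_segment[OF lim_const_over_n[of c], of 1] by simp

lemma c0_norm_le:
  "(\<And>n. w n * cmod (x n) \<le> B) \<Longrightarrow> c0_norm w x \<le> B"
  unfolding c0_norm_def by (rule cSUP_least) auto

lemma c0_norm_nonneg: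
  assumes "\<And>n. 0 < w n" "x \<in> c0 w"
  shows "0 \<le> c0_norm w x"
  using c0_norm_upper[OF assms(2), of 0] assms(1)[of 0]
  by (meson less_imp_le mult_nonneg_nonneg norm_ge_zero order_trans)

lemma c0_scale:
  assumes "x \<in> c0 w"
  shows "(\<lambda>n. c * x n) \<in> c0 w"
  using tendsto_mult_left[of "\<lambda>n. w n * cmod (x n)" 0 sequentially "cmod c"] assms
  by (simp add: c0_def norm_mult mult.left_commute)

lemma c0_finite_support:
  assumes "\<And>n. n \<ge> N \<Longrightarrow> x n = 0"
  shows "x \<in> c0 w"
  unfolding c0_def mem_Collect_eq
  by (rule tendsto_eventually) (auto simp: eventually_sequentially assms intro!: exI[of _ N])

lemma c0_dominated:
  assumes "\<And>n. 0 < w n" "\<And>n. w n * cmod (x n) \<le> b n" "b \<longlonglongrightarrow> 0"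
  shows "x \<in> c0 w"
  unfolding c0_def mem_Collect_eq
  by (rule Lim_null_comparison[OF _ assms(3)])
     (use assms(2) in \<open>simp add: abs_mult abs_of_pos[OF assms(1)]\<close>)

lemma c0_bounded:
  assumes "\<And>n. 0 < w n" "w \<longlonglongrightarrow> 0" "\<And>n. cmod (x n) \<le> B"
  shows "x \<in> c0 w"
proof (rule c0_dominated[OF assms(1)])
  show "w n * cmod (x n) \<le> w n * B" for n
    using assms(1)[of n] assms(3)[of n] by (intro mult_left_mono) auto
  show "(\<lambda>n. w n * B) \<longlonglongrightarrow> 0"
    using tendsto_mult_right[OF assms(2), of B] by simp
qed

lemma topspace_c0:
  "(\<And>n. 0 < w n) \<Longrightarrow> topspace (norm_topology (c0 w) (c0_norm w)) = c0 w"
  unfolding norm_topology_def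
  by (rule Metric_space.topspace_mtopology[OF Metric_space_c0]) auto

lemma bounded_linear_in_cont_linear_ops:
  assumes w: "\<And>n. 0 < w n"
    and maps: "\<And>x. x \<in> c0 w \<Longrightarrow> T x \<in> c0 w"
    and add: "\<And>x y. x \<in> c0 w \<Longrightarrow> y \<in> c0 w \<Longrightarrow> T (\<lambda>n. x n + y n) = (\<lambda>n. T x n + T y n)"
    and scale: "\<And>c x. x \<in> c0 w \<Longrightarrow> T (\<lambda>n. c * x n) = (\<lambda>n. c * T x n)"
    and bound: "\<And>x. x \<in> c0 w \<Longrightarrow> c0_norm w (T x) \<le> M * c0_norm w x"
  shows "T \<in> cont_linear_ops (c0 w) (c0_norm w)"
proof -
  interpret Metric_space "c0 w" "seq_dist (c0 w) (c0_norm w)"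
    by (rule Metric_space_c0[OF w])
  have diff: "T (\<lambda>n. x n - y n) = (\<lambda>n. T x n - T y n)" if "x \<in> c0 w" "y \<in> c0 w" for x y
    using add[OF that(1) c0_scale[OF that(2), of "-1"]] scale[OF that(2), of "-1"] by simp
  have lip: "seq_dist (c0 w) (c0_norm w) (T x) (T y) \<le> (\<bar>M\<bar> + 1) * seq_dist (c0 w) (c0_norm w) x y"
    if "x \<in> c0 w" "y \<in> c0 w" for x y
  proof -
    have *: "(\<lambda>n. x n - y n) \<in> c0 w" by (rule c0_diff[OF w that])
    have "c0_norm w (\<lambda>n. T x n - T y n) \<le> M * c0_norm w (\<lambda>n. x n - y n)"
      using bound[OF *] diff[OF that] by simp
    also have "\<dots> \<le> (\<bar>M\<bar> + 1) * c0_norm w (\<lambda>n. x n - y n)"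
      using c0_norm_nonneg[OF w *] by (intro mult_right_mono) auto
    finally show ?thesis using that maps by (simp add: seq_dist_def)
  qed
  have "continuous_map mtopology mtopology T"
    unfolding metric_continuous_map[OF Metric_space_axioms]
  proof (intro conjI ballI allI impI)
    show "T ` c0 w \<subseteq> c0 w" using maps by auto
    fix a and e :: real assume a: "a \<in> c0 w" and e: "0 < e"
    show "\<exists>d>0. \<forall>x. x \<in> c0 w \<and> seq_dist (c0 w) (c0_norm w) a x < d \<longrightarrow>
        seq_dist (c0 w) (c0_norm w) (T a) (T x) < e"
    proof (intro exI[of _ "e / (\<bar>M\<bar> + 1)"] conjI allI impI)
      show "0 < e / (\<bar>M\<bar> + 1)" using e by simp
      fix x assume x: "x \<in> c0 w \<and> seq_dist (c0 w) (c0_norm w) a x < e / (\<bar>M\<bar> + 1)"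
      then have "(\<bar>M\<bar> + 1) * seq_dist (c0 w) (c0_norm w) a x < e"
        by (simp add: field_simps)
      then show "seq_dist (c0 w) (c0_norm w) (T a) (T x) < e"
        using lip[OF a, of x] x by auto
    qed
  qed
  then show ?thesis
    unfolding cont_linear_ops_def norm_topology_def using maps add scale by auto
qed

text \<open>
  On a set of sequences dominated by a null sequence, coordinatewise convergence is already
  convergence in norm: all but finitely many coordinates are uniformly small. The set is thus a
  continuous image of a product of compact discs.
\<close>

lemma compactin_null_dominated:
  assumes w: "\<And>n. 0 < w n" and b: "b \<longlonglongrightarrow> 0"
  shows "compactin (norm_topology (c0 w) (c0_norm w)) {x. \<forall>n. w n * cmod (x n) \<le> b n}"
proof -
  interpret Metric_space "c0 w" "seq_dist (c0 w) (c0_norm w)"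
    by (rule Metric_space_c0[OF w])
  define D where "D n = cball (0::complex) (b n / w n)" for n
  define P where "P = product_topology (\<lambda>n. top_of_set (D n)) UNIV"
  have D_iff: "z \<in> D n \<longleftrightarrow> w n * cmod z \<le> b n" for z n
    using w[of n] by (simp add: D_def field_simps)
  have top: "topspace P = {x. \<forall>n. w n * cmod (x n) \<le> b n}"
    by (auto simp: P_def PiE_iff D_iff)
  have sub: "topspace P \<subseteq> c0 w"
    unfolding top by (auto intro: c0_dominated[of w _ b, OF w _ b])
  have "compact_space P"
    unfolding P_def compact_space_product_topology
    by (auto simp: compact_space_subtopology D_def)
  then have "compactin P (topspace P)"
    by (simp add: compact_space_def)
  moreover have "continuous_map P mtopology id"
    unfolding continuous_map_to_metric
  proof (intro ballI allI impI)
    fix x and e :: real assume x: "x \<in> topspace P" and e: "0 < e"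
    have "\<forall>\<^sub>F n in sequentially. b n < e / 4"
      using order_tendstoD(2)[OF b, of "e / 4"] e by simp
    then obtain N where N: "\<And>n. n \<ge> N \<Longrightarrow> b n < e / 4"
      unfolding eventually_sequentially by blast
    define U where "U = Pi\<^sub>E UNIV (\<lambda>n. if n < N then D n \<inter> ball (x n) (e / (2 * w n)) else D n)"
    have "openin P U"
      unfolding P_def U_def openin_PiE_gen
      by (intro disjI2 conjI) (auto intro: finite_subset[of _ "{..<N}"] simp: openin_open_Int)
    moreover have "x \<in> U"
      using x e w by (auto simp: U_def top PiE_iff D_iff)
    moreover have "id y \<in> mball (id x) e" if y: "y \<in> U" for y
    proof -
      have "y \<in> topspace P"
        using \<open>openin P U\<close> openin_subset y by blast
      then have xy: "x \<in> c0 w" "y \<in> c0 w"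
        and xb: "w n * cmod (x n) \<le> b n" and yb: "w n * cmod (y n) \<le> b n" for n
        using x sub top by auto
      have "w n * cmod (x n - y n) \<le> e / 2" for n
      proof (cases "n < N")
        case True
        then have "cmod (x n - y n) < e / (2 * w n)"
          using y by (auto simp: U_def PiE_iff dist_norm dest!: spec[of _ n])
        then show ?thesis using w[of n] by (simp add: field_simps)
      next
        case False
        have "w n * cmod (x n - y n) \<le> w n * (cmod (x n) + cmod (y n))"
          using w[of n] by (intro mult_left_mono norm_triangle_ineq4) auto
        then show ?thesis using xb[of n] yb[of n] N[of n] False by (simp add: distrib_left)
      qed
      then have "c0_norm w (\<lambda>n. x n - y n) \<le> e / 2" by (rule c0_norm_le)
      then show ?thesis using e xy by (simp add: seq_dist_def)
    qed
    ultimately show "\<exists>U. openin P U \<and> x \<in> U \<and> (\<forall>y\<in>U. id y \<in> mball (id x) e)" by blast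
  qed
  ultimately have "compactin mtopology (id ` topspace P)" by (rule image_compactin)
  then show ?thesis by (simp add: norm_topology_def top)
qed

lemma finite_support_dense:
  assumes w: "\<And>n. 0 < w n" and "R \<subseteq> c0 w"
    and R: "\<And>y N. (\<And>n. n \<ge> N \<Longrightarrow> y n = 0) \<Longrightarrow> y \<in> R"
  shows "norm_topology (c0 w) (c0_norm w) closure_of R = c0 w"
proof -
  interpret Metric_space "c0 w" "seq_dist (c0 w) (c0_norm w)"
    by (rule Metric_space_c0[OF w])
  have "\<exists>y\<in>R. y \<in> mball x r" if x: "x \<in> c0 w" and r: "0 < r" for x r
  proof -
    have "\<forall>\<^sub>F n in sequentially. w n * cmod (x n) < r / 2"
      using order_tendstoD(2)[of "\<lambda>n. w n * cmod (x n)" 0 sequentially "r / 2"] x r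
      by (simp add: c0_def)
    then obtain N where N: "\<And>n. n \<ge> N \<Longrightarrow> w n * cmod (x n) < r / 2"
      unfolding eventually_sequentially by blast
    define y where "y n = (if n < N then x n else 0)" for n
    have yR: "y \<in> R" by (rule R[of N]) (simp add: y_def)
    have "w n * cmod (x n - y n) \<le> r / 2" for n
      using N[of n] r by (auto simp: y_def)
    then have "c0_norm w (\<lambda>n. x n - y n) \<le> r / 2" by (rule c0_norm_le)
    then have "y \<in> mball x r"
      using r x yR assms(2) by (auto simp: seq_dist_def)
    with yR show ?thesis by blast
  qed
  then show ?thesis unfolding norm_topology_def metric_closure_of by auto
qed

section \<open>The Cesaro operator and its recursion\<close>

lemma cesaro_0: "cesaro t x 0 = x 0"
  by (simp add: cesaro_def)

lemma cesaro_Suc: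
  "of_nat (n + 2) * cesaro t x (Suc n) = of_real t * of_nat (n + 1) * cesaro t x n + x (Suc n)"
proof -
  have "(\<Sum>k = 0..n. of_real t ^ (Suc n - k) * x k)
      = of_real t * (\<Sum>k = 0..n. of_real t ^ (n - k) * x k)"
    unfolding sum_distrib_left by (rule sum.cong) (auto simp: Suc_diff_le)
  moreover have "of_nat (n + 2) \<noteq> (0::complex)" "of_nat (n + 1) \<noteq> (0::complex)"
    by (simp_all only: of_nat_eq_0_iff)
  ultimately show ?thesis
    by (simp add: cesaro_def del: of_nat_Suc of_nat_add)
qed

lemma cesaro_eq_iff:
  "cesaro t x = z \<longleftrightarrow> x 0 = z 0 \<and>
     (\<forall>n. x (Suc n) = of_nat (n + 2) * z (Suc n) - of_real t * of_nat (n + 1) * z n)"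
  (is "_ \<longleftrightarrow> ?R")
proof
  assume "cesaro t x = z"
  then show ?R using cesaro_0[of t x] cesaro_Suc[of _ t x]
    by (metis add_diff_cancel_left')
next
  assume R: ?R
  have "cesaro t x n = z n" for n
  proof (induction n)
    case 0
    then show ?case using R by (simp add: cesaro_0)
  next
    case (Suc n)
    have "of_nat (n + 2) * cesaro t x (Suc n) = of_nat (n + 2) * z (Suc n)"
      using cesaro_Suc[of n t x] R Suc by simp
    moreover have "of_nat (n + 2) \<noteq> (0::complex)" by (simp only: of_nat_eq_0_iff)
    ultimately show ?case by (metis mult_left_cancel)
  qed
  then show "cesaro t x = z" by auto
qed

lemma cesaro_add: "cesaro t (\<lambda>n. x n + y n) = (\<lambda>n. cesaro t x n + cesaro t y n)"
  by (simp add: cesaro_def sum.distrib distrib_left)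

lemma cesaro_scale: "cesaro t (\<lambda>n. c * x n) = (\<lambda>n. c * cesaro t x n)"
  by (simp add: cesaro_def sum_distrib_left mult_ac)

text \<open>
  Because \<open>w\<close> decreases, \<open>w\<^sub>n\<close> may be replaced by \<open>w\<^sub>k\<close> inside the sum; what remains is a partial
  sum of the geometric series. The factor \<open>1 / (n + 1)\<close> is kept since it is the source of
  compactness.
\<close>

lemma cesaro_weighted_bound:
  assumes t: "0 \<le> t" "t < 1" and w: "\<And>n. 0 < w n" "decseq w"
    and M: "\<And>n. w n * cmod (x n) \<le> M"
  shows "w n * cmod (cesaro t x n) \<le> M / (1 - t) / real (n + 1)"
proof -
  have M0: "0 \<le> M" using M[of 0] w(1)[of 0]
    by (meson less_imp_le mult_nonneg_nonneg norm_ge_zero order_trans)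
  have "w n * cmod (\<Sum>k=0..n. of_real t ^ (n - k) * x k)
      \<le> w n * (\<Sum>k=0..n. t ^ (n - k) * cmod (x k))"
    using w(1)[of n] t(1)
    by (intro mult_left_mono order_trans[OF norm_sum]) (auto simp: norm_mult norm_power)
  also have "\<dots> = (\<Sum>k=0..n. t ^ (n - k) * (w n * cmod (x k)))"
    by (simp add: sum_distrib_left mult_ac)
  also have "\<dots> \<le> (\<Sum>k=0..n. t ^ (n - k) * M)"
  proof (intro sum_mono mult_left_mono)
    fix k assume "k \<in> {0..n}"
    then have "w n * cmod (x k) \<le> w k * cmod (x k)"
      using w(2) by (intro mult_right_mono) (auto simp: decseq_def)
    then show "w n * cmod (x k) \<le> M" using M[of k] by linarith
  qed (use t in auto)
  also have "\<dots> = M * (\<Sum>k<Suc n. t ^ k)"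
    using sum.nat_diff_reindex[of "\<lambda>k. t ^ k" "Suc n"]
    by (simp add: sum_distrib_right[symmetric] atLeast0AtMost lessThan_Suc_atMost)
  also have "\<dots> \<le> M * (1 / (1 - t))"
    using t M0 by (intro mult_left_mono) (simp_all only: sum_gp_strict, auto simp: divide_right_mono)
  finally have "w n * cmod (\<Sum>k=0..n. of_real t ^ (n - k) * x k) / real (n + 1)
      \<le> M * (1 / (1 - t)) / real (n + 1)"
    by (rule divide_right_mono) simp
  moreover have "cmod (cesaro t x n) = cmod (\<Sum>k=0..n. of_real t ^ (n - k) * x k) / real (n + 1)"
    unfolding cesaro_def norm_mult norm_divide norm_of_nat by simp
  ultimately show ?thesis by simp
qed

lemma cesaro_weighted_bounded_in_c0:
  assumes "0 \<le> t" "t < 1" "\<And>n. 0 < w n" "decseq w" "\<And>n. w n * cmod (x n) \<le> M"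
  shows "cesaro t x \<in> c0 w"
  by (rule c0_dominated[OF assms(3) cesaro_weighted_bound[OF assms] tendsto_const_div_Suc])

lemma cesaro_in_c0:
  assumes "0 \<le> t" "t < 1" "\<And>n. 0 < w n" "decseq w" "x \<in> c0 w"
  shows "cesaro t x \<in> c0 w"
  using cesaro_weighted_bounded_in_c0[OF assms(1-4)] c0_norm_upper[OF assms(5)] by blast

lemma cesaro_norm_le:
  assumes t: "0 \<le> t" "t < 1" and w: "\<And>n. 0 < w n" "decseq w" and x: "x \<in> c0 w"
  shows "c0_norm w (cesaro t x) \<le> 1 / (1 - t) * c0_norm w x"
proof (rule c0_norm_le)
  fix n
  have "w n * cmod (cesaro t x n) \<le> c0_norm w x / (1 - t) / real (n + 1)"
    by (rule cesaro_weighted_bound[OF t w c0_norm_upper[OF x]])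
  also have "\<dots> \<le> c0_norm w x / (1 - t) / 1"
    using c0_norm_nonneg[OF w(1) x] t by (intro divide_left_mono) auto
  finally show "w n * cmod (cesaro t x n) \<le> 1 / (1 - t) * c0_norm w x" by simp
qed

lemma cesaro_cont_linear:
  assumes "0 \<le> t" "t < 1" "\<And>n. 0 < w n" "decseq w"
  shows "cesaro t \<in> cont_linear_ops (c0 w) (c0_norm w)"
  by (rule bounded_linear_in_cont_linear_ops[OF assms(3)])
     (rule cesaro_in_c0[OF assms] cesaro_add cesaro_scale cesaro_norm_le[OF assms]; assumption)+

lemma cesaro_op_norm_le:
  assumes t: "0 \<le> t" "t < 1" and w: "\<And>n. 0 < w n" "decseq w"
  shows "op_norm (c0 w) (c0_norm w) (cesaro t) \<le> 1 / (1 - t)"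
  unfolding op_norm_def
proof (rule cSUP_least)
  have "(\<lambda>n. 0) \<in> c0 w" "c0_norm w (\<lambda>n. 0) \<le> 1"
    by (auto simp: c0_def intro: c0_norm_le)
  then show "{x \<in> c0 w. c0_norm w x \<le> 1} \<noteq> {}" by blast
  fix x assume "x \<in> {x \<in> c0 w. c0_norm w x \<le> 1}"
  then have x: "x \<in> c0 w" "c0_norm w x \<le> 1" by auto
  have "1 / (1 - t) * c0_norm w x \<le> 1 / (1 - t) * 1"
    using x t by (intro mult_left_mono) auto
  then show "c0_norm w (cesaro t x) \<le> 1 / (1 - t)"
    using cesaro_norm_le[OF t w x(1)] by simp
qed

lemma cesaro_compact:
  assumes t: "0 \<le> t" "t < 1" and w: "\<And>n. 0 < w n" "decseq w"
  shows "compact_op (c0 w) (c0_norm w) (cesaro t)"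
  unfolding compact_op_def
proof
  let ?X = "norm_topology (c0 w) (c0_norm w)"
  let ?K = "{x. \<forall>n. w n * cmod (x n) \<le> 1 / (1 - t) / real (n + 1)}"
  let ?A = "cesaro t ` {x \<in> c0 w. c0_norm w x \<le> 1}"
  show "cesaro t \<in> cont_linear_ops (c0 w) (c0_norm w)"
    by (rule cesaro_cont_linear[OF t w])
  have K: "compactin ?X ?K"
    by (rule compactin_null_dominated[OF w(1) tendsto_const_div_Suc])
  have "Hausdorff_space ?X"
    unfolding norm_topology_def by (rule Metric_space.Hausdorff_space_mtopology[OF Metric_space_c0[OF w(1)]])
  then have "closedin ?X ?K" using K by (rule compactin_imp_closedin)
  moreover have "?A \<subseteq> ?K"
  proof clarify
    fix x n assume x: "x \<in> c0 w" "c0_norm w x \<le> 1"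
    show "w n * cmod (cesaro t x n) \<le> 1 / (1 - t) / real (n + 1)"
      by (rule cesaro_weighted_bound[OF t w order_trans[OF c0_norm_upper[OF x(1)] x(2)]])
  qed
  ultimately have "?X closure_of ?A \<subseteq> ?K" by (simp add: closure_of_minimal)
  then show "compactin ?X (?X closure_of ?A)"
    by (rule closed_compactin[OF K]) simp
qed

section \<open>Eigenvalues\<close>

lemma Lam_iff: "l \<in> Lam \<longleftrightarrow> (\<exists>n. 1 - l * of_nat (n + 1) = 0)"
proof -
  have "l = 1 / of_nat (n + 1) \<longleftrightarrow> 1 - l * of_nat (n + 1) = 0" for n
  proof -
    have "of_nat (n + 1) \<noteq> (0::complex)" by (simp only: of_nat_eq_0_iff)
    then show ?thesis by (auto simp: field_simps simp del: of_nat_add of_nat_Suc)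
  qed
  then show ?thesis unfolding Lam_def by auto
qed

text \<open>
  Substituting \<open>z = l x\<close> in the recursion gives \<open>(1 - l (n + 1)) x\<^sub>n = - l t n x\<^sub>n\<^sub>-\<^sub>1\<close>, which forces
  \<open>x = 0\<close> unless some leading coefficient vanishes.
\<close>

lemma cesaro_eigenvector_zero:
  assumes l: "l \<notin> Lam" and eq: "cesaro t x = (\<lambda>n. l * x n)"
  shows "x n = 0"
proof (induction n)
  case 0
  have "x 0 * (1 - l * of_nat (0 + 1)) = 0"
    using eq unfolding cesaro_eq_iff by (simp add: algebra_simps)
  then show ?case using l unfolding Lam_iff mult_eq_0_iff by blast
next
  case (Suc n)
  have "x (Suc n) = of_nat (Suc n + 1) * (l * x (Suc n)) - of_real t * of_nat (n + 1) * (l * x n)"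
    using eq unfolding cesaro_eq_iff by simp
  then have "x (Suc n) * (1 - l * of_nat (Suc n + 1)) = 0"
    using Suc by (simp add: algebra_simps)
  then show ?case using l unfolding Lam_iff mult_eq_0_iff by blast
qed

lemma minus_scalar_cesaro_inj:
  assumes "l \<notin> Lam"
  shows "inj (minus_scalar (cesaro t) l)"
proof (rule injI)
  fix x y assume "minus_scalar (cesaro t) l x = minus_scalar (cesaro t) l y"
  then have *: "cesaro t x n - l * x n = cesaro t y n - l * y n" for n
    by (auto simp: minus_scalar_def fun_eq_iff)
  have "cesaro t (\<lambda>n. x n + (-1) * y n) = (\<lambda>n. l * (x n + (-1) * y n))"
    unfolding cesaro_add cesaro_scale using * by (auto simp: algebra_simps)
  from cesaro_eigenvector_zero[OF assms this] show "x = y" by auto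
qed

lemma cesaro_eigenvector:
  "cesaro t (\<lambda>n. of_nat (n choose m) * of_real t ^ (n - m))
    = (\<lambda>n. 1 / of_nat (m + 1) * (of_nat (n choose m) * of_real t ^ (n - m)))"
  (is "cesaro t ?x = _")
proof -
  have nz: "of_nat (m + 1) \<noteq> (0::complex)" by (simp only: of_nat_eq_0_iff)
  have rec: "of_nat (m + 1) * ?x (Suc n) = of_nat (n + 2) * ?x (Suc n) - of_real t * of_nat (n + 1) * ?x n"
    for n
  proof (cases "m \<le> n")
    case True
    have "(Suc n - m) * (Suc n choose m) = Suc n * (n choose m)"
      using binomial_absorb_comp[of "Suc n" m] by simp
    then have "of_nat (Suc n - m) * of_nat (Suc n choose m) = (of_nat (Suc n) * of_nat (n choose m) :: complex)"
      by (metis of_nat_mult)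
    moreover have "of_nat (Suc n - m) = (of_nat (n + 2) - of_nat (m + 1) :: complex)"
      using True by (simp add: of_nat_diff)
    ultimately have "(of_nat (n + 2) - of_nat (m + 1)) * of_nat (Suc n choose m) * of_real t ^ (Suc n - m)
        = of_nat (n + 1) * of_nat (n choose m) * (of_real t ^ (Suc n - m) :: complex)"
      by simp
    moreover have "of_real t ^ (Suc n - m) = (of_real t * of_real t ^ (n - m) :: complex)"
      using True by (simp add: Suc_diff_le)
    ultimately show ?thesis
      by (simp add: algebra_simps del: of_nat_add of_nat_Suc)
  next
    case False
    then have "n choose m = 0" "n + 1 = m \<or> Suc n choose m = 0" by (auto simp: binomial_eq_0)
    then show ?thesis by (auto simp: binomial_eq_0)
  qed
  have "?x (Suc n) = of_nat (n + 2) * (1 / of_nat (m + 1) * ?x (Suc n))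
      - of_real t * of_nat (n + 1) * (1 / of_nat (m + 1) * ?x n)" for n
  proof -
    have "?x (Suc n) = (of_nat (m + 1) * ?x (Suc n)) / of_nat (m + 1)"
      using nz by (simp del: of_nat_add of_nat_Suc)
    also have "\<dots> = (of_nat (n + 2) * ?x (Suc n) - of_real t * of_nat (n + 1) * ?x n) / of_nat (m + 1)"
      by (simp only: rec)
    finally show ?thesis by (simp add: diff_divide_distrib del: of_nat_add of_nat_Suc)
  qed
  moreover have "?x 0 = 1 / of_nat (m + 1) * ?x 0" by (cases m) auto
  ultimately show ?thesis unfolding cesaro_eq_iff by blast
qed

text \<open>
  The binomial theorem for \<open>(t + (1 - t))\<^sup>n = 1\<close> contains the term
  \<open>(n choose m) t\<^sup>n\<^sup>-\<^sup>m (1 - t)\<^sup>m\<close>.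
\<close>

lemma choose_geometric_bound:
  assumes t: "0 \<le> t" "t < (1::real)"
  shows "real (n choose m) * t ^ (n - m) \<le> 1 / (1 - t) ^ m"
proof (cases "m \<le> n")
  case True
  have "real (n choose m) * (1 - t) ^ m * t ^ (n - m)
      \<le> (\<Sum>k\<le>n. real (n choose k) * (1 - t) ^ k * t ^ (n - k))"
    using True t by (intro member_le_sum) auto
  also have "\<dots> = ((1 - t) + t) ^ n" by (rule binomial_ring[symmetric])
  finally show ?thesis using t by (simp add: field_simps)
qed (use t in \<open>simp add: binomial_eq_0\<close>)

lemma cesaro_point_spectrum:
  assumes t: "0 \<le> t" "t < 1" and w: "\<And>n. 0 < w n" "w \<longlonglongrightarrow> 0"
  shows "point_spectrum (c0 w) (cesaro t) = Lam"
proof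
  show "point_spectrum (c0 w) (cesaro t) \<subseteq> Lam"
    unfolding point_spectrum_def using minus_scalar_cesaro_inj inj_on_subset by blast
  show "Lam \<subseteq> point_spectrum (c0 w) (cesaro t)"
  proof
    fix l assume "l \<in> Lam"
    then obtain m where l: "l = 1 / of_nat (m + 1)" by (auto simp: Lam_def)
    define x :: cseq where "x = (\<lambda>n. of_nat (n choose m) * of_real t ^ (n - m))"
    have "x \<in> c0 w"
      by (rule c0_bounded[OF w, of _ "1 / (1 - t) ^ m"])
         (use choose_geometric_bound[OF t] t in \<open>simp add: x_def norm_mult norm_power\<close>)
    moreover have "(\<lambda>n. 0) \<in> c0 w" by (simp add: c0_def)
    moreover have "minus_scalar (cesaro t) l x = minus_scalar (cesaro t) l (\<lambda>n. 0)"
      unfolding minus_scalar_def x_def cesaro_eigenvector l by (simp add: cesaro_def)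
    moreover have "x m = 1" by (simp add: x_def)
    then have "x \<noteq> (\<lambda>n. 0)" by auto
    ultimately show "l \<in> point_spectrum (c0 w) (cesaro t)"
      unfolding point_spectrum_def inj_on_def by blast
  qed
qed

section \<open>The resolvent\<close>

lemma minus_scalar_cesaro_solvable:
  assumes l: "l \<notin> Lam" "l \<noteq> 0"
  shows "\<exists>x. minus_scalar (cesaro t) l x = y"
proof -
  \<comment> \<open>\<open>z\<close> is to become \<open>cesaro t x\<close>; its recursion comes from eliminating \<open>x = (z - y) / l\<close>.\<close>
  define z where "z = rec_nat (y 0 / (1 - l))
    (\<lambda>n v. (y (Suc n) - l * of_real t * of_nat (n + 1) * v) / (1 - l * of_nat (n + 2)))"
  have nz: "1 - l * of_nat (n + 1) \<noteq> 0" for n using l(1) unfolding Lam_iff by blast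
  have z0: "z 0 - y 0 = l * z 0"
    using nz[of 0] by (simp add: z_def field_simps)
  have zS: "z (Suc n) - y (Suc n) = l * (of_nat (n + 2) * z (Suc n) - of_real t * of_nat (n + 1) * z n)" for n
  proof -
    have "z (Suc n) * (1 - l * of_nat (n + 2)) = y (Suc n) - l * of_real t * of_nat (n + 1) * z n"
      using nz[of "n + 1"] by (simp add: z_def)
    then show ?thesis by (simp add: algebra_simps)
  qed
  have "cesaro t (\<lambda>n. (z n - y n) / l) = z"
    unfolding cesaro_eq_iff z0 zS using l(2) by simp
  then have "minus_scalar (cesaro t) l (\<lambda>n. (z n - y n) / l) = y"
    using l(2) by (simp add: minus_scalar_def)
  then show ?thesis by blast
qed

text \<open>
  The numbers \<open>K n\<close> in the proof solve the recursion with equality and \<open>V = 1\<close>. They stay bounded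
  because \<open>\<bar>1 - l (n + 2)\<bar>\<close> exceeds \<open>\<bar>l\<bar> t (n + 1)\<close> by an amount that tends to infinity.
\<close>

lemma resolvent_recursion_bound:
  assumes t: "0 \<le> t" "t < 1" and l: "l \<notin> Lam" "l \<noteq> 0"
  obtains C where "0 \<le> C"
    and "\<And>u V n. cmod (1 - l) * u 0 \<le> V \<Longrightarrow>
      (\<And>n. cmod (1 - l * of_nat (n + 2)) * u (Suc n) \<le> V + cmod l * t * real (n + 1) * u n) \<Longrightarrow>
      0 \<le> V \<Longrightarrow> u n \<le> C * V"
proof -
  define q where "q n = cmod (1 - l * of_nat (n + 1))" for n
  define K where "K = rec_nat (1 / q 0) (\<lambda>n v. (1 + cmod l * t * real (n + 1) * v) / q (Suc n))"
  have q: "0 < q n" for n using l(1) unfolding Lam_iff q_def by auto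
  have K0: "q 0 * K 0 = 1" and KS: "q (Suc n) * K (Suc n) = 1 + cmod l * t * real (n + 1) * K n" for n
    using q[of 0] q[of "Suc n"] by (simp_all add: K_def)
  have Kpos: "0 \<le> K n" for n
  proof (induction n)
    case 0 then show ?case using K0 q[of 0] by (simp add: K_def)
  next
    case (Suc n)
    then have "0 \<le> q (Suc n) * K (Suc n)" unfolding KS using t by simp
    then show ?case using q[of "Suc n"] by (simp add: zero_le_mult_iff)
  qed
  \<comment> \<open>From this \<open>N\<close> on, \<open>1 + \<bar>l\<bar> t (n + 1) R \<le> \<bar>1 - l (n + 2)\<bar> R\<close> for every \<open>R \<ge> 1\<close>, so that any bound
    of at least \<open>1\<close> on \<open>K n\<close> passes to \<open>K (n + 1)\<close>.\<close>
  obtain N where N: "2 / (cmod l * (1 - t)) \<le> real N" using real_arch_simple by blast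
  define R where "R = max 1 (K N)"
  have KR: "K n \<le> R" if "n \<ge> N" for n
    using that
  proof (induction n rule: dec_induct)
    case base show ?case by (simp add: R_def)
  next
    case (step n)
    have "2 \<le> cmod l * (1 - t) * real (n + 1)"
    proof -
      have "2 / (cmod l * (1 - t)) \<le> real (n + 1)" using N step(1) by simp
      then show ?thesis using l(2) t by (simp add: field_simps)
    qed
    then have "R * 2 \<le> R * (cmod l * (1 - t) * real (n + 1))"
      by (intro mult_left_mono) (auto simp: R_def)
    moreover have R1: "1 \<le> R" by (simp add: R_def)
    moreover have "0 \<le> R * cmod l" using R1 by (intro mult_nonneg_nonneg) auto
    moreover have "R * (cmod l * real (n + 2) - 1)
        = R * (cmod l * (1 - t) * real (n + 1)) + cmod l * t * real (n + 1) * R + R * cmod l - R"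
      by (simp add: algebra_simps)
    ultimately have 1: "1 + cmod l * t * real (n + 1) * R \<le> R * (cmod l * real (n + 2) - 1)"
      by linarith
    have "cmod l * real (n + 2) - 1 \<le> q (Suc n)"
      using norm_triangle_ineq2[of "l * of_nat (n + 2)" 1]
      unfolding q_def norm_mult norm_of_nat by (simp add: norm_minus_commute norm_mult)
    then have "R * (cmod l * real (n + 2) - 1) \<le> R * q (Suc n)"
      by (intro mult_left_mono) (auto simp: R_def)
    moreover have "cmod l * t * real (n + 1) * K n \<le> cmod l * t * real (n + 1) * R"
      using step t by (intro mult_left_mono) auto
    ultimately have "q (Suc n) * K (Suc n) \<le> R * q (Suc n)"
      using 1 unfolding KS by linarith
    then have "q (Suc n) * K (Suc n) \<le> q (Suc n) * R" by (simp only: mult.commute)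
    then show ?case using q[of "Suc n"] by simp
  qed
  define C where "C = R + (\<Sum>n<N. K n)"
  have C0: "0 \<le> C" using Kpos by (auto simp: C_def R_def intro!: add_nonneg_nonneg sum_nonneg)
  have KC: "K n \<le> C" for n
  proof (cases "n < N")
    case True
    then have "K n \<le> (\<Sum>n<N. K n)" using Kpos by (intro member_le_sum) auto
    then show ?thesis by (simp add: C_def R_def)
  next
    case False
    then show ?thesis using KR[of n] Kpos by (auto simp: C_def intro!: add_increasing2 sum_nonneg)
  qed
  show ?thesis
  proof (rule that[OF C0])
    fix u V n
    assume u0: "cmod (1 - l) * u 0 \<le> V" and V: "0 \<le> V"
      and uS: "\<And>n. cmod (1 - l * of_nat (n + 2)) * u (Suc n) \<le> V + cmod l * t * real (n + 1) * u n"
    have "u n \<le> K n * V" for n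
    proof (induction n)
      case 0
      have "q 0 * u 0 \<le> q 0 * K 0 * V" using u0 by (simp add: K0) (simp add: q_def)
      then show ?case using q[of 0] by (simp add: mult.assoc)
    next
      case (Suc n)
      have "q (Suc n) * u (Suc n) \<le> V + cmod l * t * real (n + 1) * u n"
        using uS[of n] by (simp add: q_def)
      also have "\<dots> \<le> V + cmod l * t * real (n + 1) * (K n * V)"
        using Suc t by (intro add_left_mono mult_left_mono) auto
      also have "\<dots> = q (Suc n) * K (Suc n) * V" unfolding KS by (simp add: algebra_simps)
      finally show ?case using q[of "Suc n"] by (simp add: mult.assoc)
    qed
    also have "K n * V \<le> C * V" using KC V by (intro mult_right_mono)
    finally show "u n \<le> C * V" .
  qed
qed

text \<open>
  The recursion is applied to \<open>u\<^sub>n = w\<^sub>n \<bar>(cesaro t x)\<^sub>n\<bar>\<close>, where \<open>w\<^sub>n\<^sub>+\<^sub>1 \<le> w\<^sub>n\<close> is used once more. It only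
  bounds \<open>x\<close> with respect to \<open>w\<close>; that \<open>x\<close> lies in \<open>c0 w\<close> follows from \<open>l x = cesaro t x - y\<close>, since
  \<open>cesaro t\<close> turns this boundedness into convergence to \<open>0\<close>.
\<close>

lemma resolvent_estimate:
  assumes t: "0 \<le> t" "t < 1" and w: "\<And>n. 0 < w n" "decseq w" and l: "l \<notin> Lam" "l \<noteq> 0"
  obtains C where "\<And>x. minus_scalar (cesaro t) l x \<in> c0 w \<Longrightarrow>
    x \<in> c0 w \<and> c0_norm w x \<le> C * c0_norm w (minus_scalar (cesaro t) l x)"
proof -
  obtain C where C: "0 \<le> C"
    and rec: "\<And>u V n. cmod (1 - l) * u 0 \<le> V \<Longrightarrow>
      (\<And>n. cmod (1 - l * of_nat (n + 2)) * u (Suc n) \<le> V + cmod l * t * real (n + 1) * u n) \<Longrightarrow>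
      0 \<le> V \<Longrightarrow> u n \<le> C * V"
    using resolvent_recursion_bound[OF t l] by blast
  show ?thesis
  proof (rule that[of "(C + 1) / cmod l"])
    fix x assume "minus_scalar (cesaro t) l x \<in> c0 w"
    moreover define y where "y = minus_scalar (cesaro t) l x"
    ultimately have y: "y \<in> c0 w" by simp
    define z where "z = cesaro t x"
    define V where "V = c0_norm w y"
    have lx: "l * x n = z n - y n" for n by (simp add: y_def z_def minus_scalar_def)
    have yV: "w n * cmod (y n) \<le> V" for n unfolding V_def by (rule c0_norm_upper[OF y])
    have V0: "0 \<le> V" unfolding V_def by (rule c0_norm_nonneg[OF w(1) y])
    have zx: "x 0 = z 0" "x (Suc n) = of_nat (n + 2) * z (Suc n) - of_real t * of_nat (n + 1) * z n" for n
      using cesaro_eq_iff[of t x z] by (auto simp: z_def)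
    have "w n * cmod (z n) \<le> C * V" for n
    proof (rule rec[of "\<lambda>n. w n * cmod (z n)"])
      have "(1 - l) * z 0 = y 0" using lx[of 0] zx(1) by (simp add: algebra_simps)
      then have "cmod (1 - l) * cmod (z 0) = cmod (y 0)" by (metis norm_mult)
      then show "cmod (1 - l) * (w 0 * cmod (z 0)) \<le> V"
        using yV[of 0] by (simp add: mult.left_commute)
      fix n
      have "(1 - l * of_nat (n + 2)) * z (Suc n) = y (Suc n) - l * of_real t * of_nat (n + 1) * z n"
        using lx[of "Suc n"] unfolding zx by (simp add: algebra_simps)
      then have "cmod (1 - l * of_nat (n + 2)) * cmod (z (Suc n))
          = cmod (y (Suc n) - l * of_real t * of_nat (n + 1) * z n)"
        by (metis norm_mult)
      also have "\<dots> \<le> cmod (y (Suc n)) + cmod (l * of_real t * of_nat (n + 1) * z n)"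
        by (rule norm_triangle_ineq4)
      also have "cmod (l * of_real t * of_nat (n + 1) * z n) = cmod l * t * real (n + 1) * cmod (z n)"
        unfolding norm_mult norm_of_nat using t by simp
      finally have "w (Suc n) * (cmod (1 - l * of_nat (n + 2)) * cmod (z (Suc n)))
          \<le> w (Suc n) * (cmod (y (Suc n)) + cmod l * t * real (n + 1) * cmod (z n))"
        by (rule mult_left_mono) (use w(1)[of "Suc n"] in simp)
      also have "\<dots> = w (Suc n) * cmod (y (Suc n)) + w (Suc n) * (cmod l * t * real (n + 1) * cmod (z n))"
        by (rule distrib_left)
      also have "\<dots> \<le> V + w n * (cmod l * t * real (n + 1) * cmod (z n))"
        using w(2) t yV by (intro add_mono mult_right_mono) (auto simp: decseq_Suc_iff)
      finally show "cmod (1 - l * of_nat (n + 2)) * (w (Suc n) * cmod (z (Suc n)))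
          \<le> V + cmod l * t * real (n + 1) * (w n * cmod (z n))"
        by (simp only: mult_ac)
    qed (rule V0)
    have xb: "w n * cmod (x n) \<le> (C + 1) / cmod l * V" for n
    proof -
      have "cmod l * cmod (x n) \<le> cmod (z n) + cmod (y n)"
        unfolding norm_mult[symmetric] lx by (rule norm_triangle_ineq4)
      then have "w n * (cmod l * cmod (x n)) \<le> w n * (cmod (z n) + cmod (y n))"
        using w(1)[of n] by (intro mult_left_mono) auto
      also have "\<dots> \<le> (C + 1) * V"
        using \<open>w n * cmod (z n) \<le> C * V\<close> yV[of n] by (simp add: algebra_simps)
      finally show ?thesis using l(2) by (simp add: field_simps)
    qed
    have "z \<in> c0 w" unfolding z_def by (rule cesaro_weighted_bounded_in_c0[OF t w xb])
    then have "(\<lambda>n. 1 / l * (z n - y n)) \<in> c0 w" by (intro c0_scale c0_diff w(1) y)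
    then have "x \<in> c0 w" unfolding lx[symmetric] using l(2) by simp
    moreover have "c0_norm w x \<le> (C + 1) / cmod l * V" using xb by (rule c0_norm_le)
    ultimately show "x \<in> c0 w \<and> c0_norm w x
        \<le> (C + 1) / cmod l * c0_norm w (minus_scalar (cesaro t) l x)"
      by (simp add: V_def y_def)
  qed
qed

lemma minus_scalar_add:
  "minus_scalar (cesaro t) l (\<lambda>n. x n + y n)
    = (\<lambda>n. minus_scalar (cesaro t) l x n + minus_scalar (cesaro t) l y n)"
  by (simp add: minus_scalar_def cesaro_add algebra_simps)

lemma minus_scalar_scale:
  "minus_scalar (cesaro t) l (\<lambda>n. c * x n) = (\<lambda>n. c * minus_scalar (cesaro t) l x n)"
  by (simp add: minus_scalar_def cesaro_scale algebra_simps)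

lemma minus_scalar_cesaro_in_c0:
  assumes "0 \<le> t" "t < 1" "\<And>n. 0 < w n" "decseq w" "x \<in> c0 w"
  shows "minus_scalar (cesaro t) l x \<in> c0 w"
  unfolding minus_scalar_def
  by (rule c0_diff[OF assms(3) cesaro_in_c0[OF assms] c0_scale[OF assms(5)]])

lemma minus_scalar_cesaro_invertible:
  assumes t: "0 \<le> t" "t < 1" and w: "\<And>n. 0 < w n" "decseq w" and l: "l \<notin> Lam" "l \<noteq> 0"
  shows "invertible_op (c0 w) (c0_norm w) (minus_scalar (cesaro t) l)"
proof -
  let ?T = "minus_scalar (cesaro t) l"
  have inj: "inj ?T" by (rule minus_scalar_cesaro_inj[OF l(1)])
  have TS: "?T (inv ?T y) = y" for y
    using minus_scalar_cesaro_solvable[OF l, of t y] by (metis f_inv_into_f rangeI)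
  have ST: "inv ?T (?T x) = x" for x by (rule inv_f_f[OF inj])
  obtain C where C: "\<And>x. ?T x \<in> c0 w \<Longrightarrow> x \<in> c0 w \<and> c0_norm w x \<le> C * c0_norm w (?T x)"
    using resolvent_estimate[OF t w l] by blast
  \<comment> \<open>As \<open>?T\<close> is injective on all sequences, the inverse inherits linearity from it.\<close>
  have "inv ?T \<in> cont_linear_ops (c0 w) (c0_norm w)"
  proof (rule bounded_linear_in_cont_linear_ops[OF w(1)])
    show "inv ?T x \<in> c0 w" "c0_norm w (inv ?T x) \<le> C * c0_norm w x" if "x \<in> c0 w" for x
      using C[of "inv ?T x"] that by (simp_all add: TS)
    show "inv ?T (\<lambda>n. x n + y n) = (\<lambda>n. inv ?T x n + inv ?T y n)" for x y
      by (rule injD[OF inj]) (simp add: TS minus_scalar_add)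
    show "inv ?T (\<lambda>n. c * x n) = (\<lambda>n. c * inv ?T x n)" for c x
      by (rule injD[OF inj]) (simp add: TS minus_scalar_scale)
  qed
  then show ?thesis unfolding invertible_op_def using TS ST by blast
qed

lemma invertible_imp_bij_betw:
  assumes "invertible_op X N T" "T ` X \<subseteq> X"
  shows "bij_betw T X X"
proof -
  obtain S where S: "S \<in> cont_linear_ops X N" "\<And>x. x \<in> X \<Longrightarrow> S (T x) = x \<and> T (S x) = x"
    using assms(1) unfolding invertible_op_def by blast
  have "S ` X \<subseteq> X" using S(1) by (simp add: cont_linear_ops_def)
  with S(2) assms(2) show ?thesis by (intro bij_betw_byWitness[of X S]) auto
qed

section \<open>The range\<close>

text \<open>
  Each \<open>x\<^sub>n\<close> in the recursion depends only on \<open>z\<^sub>n\<close> and \<open>z\<^sub>n\<^sub>-\<^sub>1\<close>, so a finitely supported \<open>z\<close> has a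
  finitely supported preimage.
\<close>

lemma finite_support_in_cesaro_range:
  assumes "\<And>n. n \<ge> N \<Longrightarrow> y n = 0"
  shows "y \<in> cesaro t ` c0 w"
proof -
  define x where "x = case_nat (y 0) (\<lambda>n. of_nat (n + 2) * y (Suc n) - of_real t * of_nat (n + 1) * y n)"
  have "cesaro t x = y" unfolding cesaro_eq_iff by (simp add: x_def)
  moreover have "x \<in> c0 w"
    by (rule c0_finite_support[of "Suc N"]) (auto simp: x_def assms split: nat.split)
  ultimately show ?thesis by blast
qed

text \<open>
  For \<open>y\<^sub>n = 1 / ((n + 1) w\<^sub>n)\<close> the recursion gives \<open>w\<^sub>n x\<^sub>n = 1 - t w\<^sub>n / w\<^sub>n\<^sub>-\<^sub>1\<close>, which is at least
  \<open>1 - t\<close> for a decreasing weight.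
\<close>

lemma cesaro_not_surj:
  assumes t: "0 \<le> t" "t < 1" and w: "\<And>n. 0 < w n" "decseq w"
  shows "cesaro t ` c0 w \<noteq> c0 w"
proof
  assume range: "cesaro t ` c0 w = c0 w"
  define v where "v n = 1 / (real (n + 1) * w n)" for n
  have "(\<lambda>n. of_real (v n)) \<in> c0 w"
  proof (rule c0_dominated[OF w(1)])
    show "w n * cmod (of_real (v n)) \<le> 1 / real (n + 1)" for n
      using w(1)[of n] unfolding v_def norm_of_real by simp
  qed (rule tendsto_const_div_Suc)
  then obtain x where x: "x \<in> c0 w" "cesaro t x = (\<lambda>n. of_real (v n))"
    using range by (metis imageE)
  have "1 - t \<le> w (Suc n) * cmod (x (Suc n))" for n
  proof -
    have "x (Suc n) = of_nat (n + 2) * of_real (v (Suc n)) - of_real t * of_nat (n + 1) * of_real (v n)"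
      using x(2) unfolding cesaro_eq_iff by blast
    also have "\<dots> = of_real (real (n + 2) * v (Suc n) - t * (real (n + 1) * v n))" by simp
    also have "real (n + 2) * v (Suc n) = 1 / w (Suc n)" by (simp add: v_def)
    also have "real (n + 1) * v n = 1 / w n" unfolding v_def by simp
    finally have xn: "x (Suc n) = of_real (1 / w (Suc n) - t * (1 / w n))" .
    have "w (Suc n) / w n \<le> 1"
      using w(1)[of n] w(2) by (simp add: decseq_Suc_iff)
    then have "1 - t \<le> 1 - t * (w (Suc n) / w n)"
      using mult_left_mono[of "w (Suc n) / w n" 1 t] t by simp
    also have "\<dots> = w (Suc n) * (1 / w (Suc n) - t * (1 / w n))"
      using w(1)[of "Suc n"] by (simp add: right_diff_distrib)
    also have "\<dots> \<le> w (Suc n) * cmod (x (Suc n))"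
      unfolding xn norm_of_real using w(1)[of "Suc n"] by (intro mult_left_mono) auto
    finally show ?thesis .
  qed
  moreover have "(\<lambda>n. w (Suc n) * cmod (x (Suc n))) \<longlonglongrightarrow> 0"
    using x(1) unfolding c0_def by (auto intro: LIMSEQ_Suc)
  ultimately have "1 - t \<le> 0" by (intro LIMSEQ_le_const[of _ 0]) auto
  then show False using t by simp
qed

section \<open>The fine spectra\<close>

theorem theorem5p3:
  fixes t :: real and w :: "nat \<Rightarrow> real"
  assumes "0 \<le> t" and "t < 1"
    and "\<And>n. 0 < w n" and "decseq w" and "w \<longlonglongrightarrow> 0"
  shows "cesaro t \<in> cont_linear_ops (c0 w) (c0_norm w) \<and>
    op_norm (c0 w) (c0_norm w) (cesaro t) \<le> 1 / (1 - t) \<and>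
    compact_op (c0 w) (c0_norm w) (cesaro t) \<and>
    spectrum_op (c0 w) (c0_norm w) (cesaro t) = Lam \<union> {0} \<and>
    point_spectrum (c0 w) (cesaro t) = Lam \<and>
    continuous_spectrum (c0 w) (c0_norm w) (cesaro t) = {0} \<and>
    residual_spectrum (c0 w) (c0_norm w) (cesaro t) = {}"
proof -
  let ?X = "norm_topology (c0 w) (c0_norm w)"
  let ?T = "minus_scalar (cesaro t)"
  note tw = assms(1-4)
  have T0: "?T 0 = cesaro t" by (simp add: minus_scalar_def fun_eq_iff)
  have maps: "?T l ` c0 w \<subseteq> c0 w" for l using minus_scalar_cesaro_in_c0[OF tw] by blast
  have point: "point_spectrum (c0 w) (cesaro t) = Lam"
    by (rule cesaro_point_spectrum[OF assms(1-3,5)])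
  then have inj: "inj_on (?T l) (c0 w) \<longleftrightarrow> l \<notin> Lam" for l
    by (auto simp: point_spectrum_def)
  have zero: "0 \<notin> Lam" unfolding Lam_iff by simp
  have dense: "?X closure_of (cesaro t ` c0 w) = c0 w"
    by (rule finite_support_dense[OF assms(3)])
       (use cesaro_in_c0[OF tw] finite_support_in_cesaro_range in blast)+
  have bij: "bij_betw (?T l) (c0 w) (c0 w)" if "invertible_op (c0 w) (c0_norm w) (?T l)" for l
    by (rule invertible_imp_bij_betw[OF that maps])
  have inv: "invertible_op (c0 w) (c0_norm w) (?T l) \<longleftrightarrow> l \<notin> Lam \<union> {0}" for l
  proof
    assume "invertible_op (c0 w) (c0_norm w) (?T l)"
    then have "inj_on (?T l) (c0 w)" "?T l ` c0 w = c0 w"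
      using bij[of l] by (simp_all only: bij_betw_def)
    then show "l \<notin> Lam \<union> {0}"
      using inj[of l] cesaro_not_surj[OF tw] T0 by (metis Un_iff singletonD)
  next
    assume "l \<notin> Lam \<union> {0}"
    then show "invertible_op (c0 w) (c0_norm w) (?T l)"
      using minus_scalar_cesaro_invertible[OF tw, of l] by simp
  qed
  have surj: "?T l ` c0 w = c0 w" if "l \<notin> Lam" "l \<noteq> 0" for l
    using bij[of l] inv[of l] that by (simp only: bij_betw_def) blast
  have full: "?X closure_of (c0 w) = c0 w"
    using closure_of_topspace[of ?X] topspace_c0[OF assms(3)] by simp
  have closure: "?X closure_of (?T l ` c0 w) = c0 w" if "l \<notin> Lam" for l
    using surj[OF that] full dense T0 by (cases "l = 0") auto
  have "continuous_spectrum (c0 w) (c0_norm w) (cesaro t) = {0}"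
    unfolding continuous_spectrum_def inj
    using closure surj zero cesaro_not_surj[OF tw] maps[of 0] T0 by (auto simp: psubset_eq)
  moreover have "residual_spectrum (c0 w) (c0_norm w) (cesaro t) = {}"
    unfolding residual_spectrum_def inj using closure by auto
  moreover have "spectrum_op (c0 w) (c0_norm w) (cesaro t) = Lam \<union> {0}"
    unfolding spectrum_op_def inv by auto
  ultimately show ?thesis
    using point cesaro_cont_linear[OF tw] cesaro_op_norm_le[OF tw] cesaro_compact[OF tw] by blast
qed

end
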